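(* Let $W\subseteq\mathbb{R}^n$ be a rational linear subspace. Then $\dot\kappa_W$ is the smallest positive integer $k$ such that for every $d\in\mathbb{Z}^n$, the polyhedron $\{x\in\mathbb{R}^n:\ x\in W+d,\ x\ge 0\}$ is $1/k$-integral.
   Context: A linear subspace is rational if it has a basis of rational vectors. An elementary vector of $W$ is a nonzero $g\in W$ with inclusion-minimal support among nonzero vectors of $W$; a circuit is the support $C$ of an elementary vector. For rational $W$ and a circuit $C$, $g^C$ denotes the integer elementary vector with support $C$ whose entries have greatest common divisor 1 (unique up to sign). The lcm-circuit imbalance measure is $\dot\kappa_W=\mathrm{lcm}\{|g^C_i|:\ C \text{ a circuit of } W,\ i\in C\}$ for nontrivial $W$, and $\dot\kappa_W=1$ for $W\in\{\{0\},\mathbb{R}^n\}$. A number is $1/k$-integral if it is an integer multiple of $1/k$; a polyhedron is $1/k$-integral if all its vertices have $1/k$-integral coordinates. *)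

theory Defs
  imports "HOL-Analysis.Analysis"
begin

definition rational_subspace :: "(real ^ 'n) set \<Rightarrow> bool" where
  "rational_subspace W \<longleftrightarrow> subspace W \<and>
     (\<exists>B. (\<forall>b\<in>B. \<forall>i. b $ i \<in> \<rat>) \<and> independent B \<and> span B = W)"

definition supp :: "real ^ 'n \<Rightarrow> 'n set" where
  "supp g = {i. g $ i \<noteq> 0}"

definition elementary_vector :: "(real ^ 'n) set \<Rightarrow> real ^ 'n \<Rightarrow> bool" where
  "elementary_vector W g \<longleftrightarrow> g \<in> W \<and> g \<noteq> 0 \<and>
     (\<forall>h\<in>W. h \<noteq> 0 \<longrightarrow> \<not> supp h \<subset> supp g)"

definition circuit :: "(real ^ 'n) set \<Rightarrow> 'n set \<Rightarrow> bool" where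
  "circuit W C \<longleftrightarrow> (\<exists>g. elementary_vector W g \<and> C = supp g)"

definition real_vec :: "int ^ 'n \<Rightarrow> real ^ 'n" where
  "real_vec d = (\<chi> i. of_int (d $ i))"

text \<open>For a circuit of a rational subspace the vector below exists and is unique up to sign;
  only the absolute values of its entries are used, so the choice of sign is irrelevant.\<close>

definition circuit_vector :: "(real ^ 'n) set \<Rightarrow> 'n set \<Rightarrow> int ^ 'n" where
  "circuit_vector W C =
     (SOME g. elementary_vector W (real_vec g) \<and> supp (real_vec g) = C \<and>
              Gcd (range (\<lambda>i. g $ i)) = 1)"

definition lcm_circuit_imbalance :: "(real ^ 'n) set \<Rightarrow> nat" where
  "lcm_circuit_imbalance W =
     (if W = {0} \<or> W = UNIV then 1
      else Lcm {nat \<bar>circuit_vector W C $ i\<bar> | C i. circuit W C \<and> i \<in> C})"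

definition inverse_integral :: "nat \<Rightarrow> real \<Rightarrow> bool" where
  "inverse_integral k a \<longleftrightarrow> (\<exists>m::int. a = of_int m * (1 / real k))"

text \<open>The vertices of a polyhedron are its extreme points.\<close>

definition inverse_integral_polyhedron :: "nat \<Rightarrow> (real ^ 'n) set \<Rightarrow> bool" where
  "inverse_integral_polyhedron k P \<longleftrightarrow>
     (\<forall>x. x extreme_point_of P \<longrightarrow> (\<forall>i. inverse_integral k (x $ i)))"

definition translate_polyhedron :: "(real ^ 'n) set \<Rightarrow> int ^ 'n \<Rightarrow> (real ^ 'n) set" where
  "translate_polyhedron W d = {x. x \<in> (\<lambda>w. w + real_vec d) ` W \<and> (\<forall>i. 0 \<le> x $ i)}"

end

theory Submission
  imports Defs
begin

text \<open>
  A point of the polyhedron is a vertex iff no nonzero vector of \<open>W\<close> vanishes on its zero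
  coordinates. If \<open>N\<close> is a minimal set of coordinates on which only the zero vector of \<open>W\<close>
  vanishes, then \<open>W\<close> has a basis of vectors that restrict to the unit vectors on \<open>N\<close>. These are
  elementary, hence quotients \<open>g\<^sup>C / g\<^sup>C\<^sub>j\<close>, and a vertex minus the shift is an integer combination
  of them; so vertices are integral up to the factor lcm. Conversely, for a circuit \<open>C\<close> and
  \<open>i \<in> C\<close>, the point \<open>d - g\<^sup>C / g\<^sup>C\<^sub>i\<close> is a vertex when \<open>d\<^sub>i = 1\<close> and the other entries of
  \<open>d\<close> are those of \<open>g\<^sup>C / g\<^sup>C\<^sub>i\<close> rounded up. If it is \<open>1/k\<close>-integral, then \<open>g\<^sup>C\<^sub>i\<close> divides every
  \<open>k g\<^sup>C\<^sub>j\<close>, hence divides \<open>k\<close> as the \<open>g\<^sup>C\<^sub>j\<close> are coprime.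
\<close>

lemma inverse_integral_iff:
  assumes "0 < k"
  shows "inverse_integral k a \<longleftrightarrow> real k * a \<in> \<int>"
  using assms by (auto simp: inverse_integral_def Ints_def field_simps)

section \<open>Elementary vectors\<close>

text \<open>Subtracting the multiple of \<open>g\<close> that cancels coordinate \<open>j\<close> of
  \<open>h\<close> leaves a vector of \<open>W\<close> whose support is strictly smaller than that
  of \<open>g\<close>, so minimality makes it zero.\<close>

lemma elementary_vector_proportional:
  assumes "subspace W" "elementary_vector W g" "h \<in> W" "supp h \<subseteq> supp g" "g $ j \<noteq> 0"
  shows "h = (h $ j / g $ j) *\<^sub>R g"
proof (rule ccontr)
  define f where "f = h - (h $ j / g $ j) *\<^sub>R g"
  assume "h \<noteq> (h $ j / g $ j) *\<^sub>R g"
  then have "f \<noteq> 0" by (simp add: f_def)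
  moreover have "f \<in> W"
    using assms unfolding f_def elementary_vector_def
    by (intro subspace_diff subspace_scale) auto
  moreover have "supp f \<subset> supp g"
  proof
    show "supp f \<subseteq> supp g" using assms(4) by (auto simp: f_def supp_def)
    have "f $ j = 0" using assms(5) by (simp add: f_def)
    then show "supp f \<noteq> supp g" using assms(5) by (auto simp: supp_def)
  qed
  ultimately show False using assms(2) by (auto simp: elementary_vector_def)
qed

lemma elementary_vector_same_supp:
  assumes "elementary_vector W g" "h \<in> W" "h \<noteq> 0" "supp h \<subseteq> supp g"
  shows "elementary_vector W h" "supp h = supp g"
proof -
  show "supp h = supp g" using assms unfolding elementary_vector_def by blast
  then show "elementary_vector W h" using assms unfolding elementary_vector_def by auto
qed

text \<open>A \<open>\<rat>\<close>-linear functional that does not vanish on some entry of a vector turns the vector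
  into a rational one without enlarging its support.\<close>

lemma rational_linear_functional:
  fixes a :: real
  assumes "a \<noteq> 0"
  obtains \<phi> :: "real \<Rightarrow> rat"
  where "\<And>x y. \<phi> (x + y) = \<phi> x + \<phi> y" "\<And>q x. \<phi> (of_rat q * x) = q * \<phi> x" "\<phi> a = 1"
proof -
  interpret V: vector_space_pair "\<lambda>(q::rat) (x::real). of_rat q * x" "\<lambda>(q::rat) (x::rat). q * x"
    by unfold_locales (auto simp: algebra_simps of_rat_add of_rat_mult)
  have "V.vs1.independent {a}"
    using assms by (simp add: V.vs1.dependent_single)
  from V.linear_independent_extend[OF this, of "\<lambda>_. 1"] obtain \<phi>
    where lin: "Vector_Spaces.linear (\<lambda>(q::rat) (x::real). of_rat q * x) (*) \<phi>" and "\<phi> a = 1"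
    by auto
  interpret L: Vector_Spaces.linear "\<lambda>(q::rat) (x::real). of_rat q * x" "(*)" \<phi> by (rule lin)
  show thesis
    by (rule that[OF L.add L.scale \<open>\<phi> a = 1\<close>])
qed

text \<open>A functional over the rationals, applied to each entry of \<open>g\<close>, gives the
  rational vector. It maps 0 to 0, so the support cannot grow, and its value 1 at a nonzero entry of
  \<open>g\<close> keeps the result nonzero.\<close>

lemma rational_vector_in_supp:
  assumes "rational_subspace W" "g \<in> W" "g \<noteq> 0"
  obtains h where "h \<in> W" "h \<noteq> 0" "supp h \<subseteq> supp g" "\<And>i. h $ i \<in> \<rat>"
proof -
  obtain B where B: "\<And>b i. b \<in> B \<Longrightarrow> b $ i \<in> \<rat>" "independent B" "span B = W"
    using assms(1) unfolding rational_subspace_def by blast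
  have fin: "finite B" using B(2) by (rule independent_imp_finite)
  obtain c where c: "g = (\<Sum>b\<in>B. c b *\<^sub>R b)"
    using assms(2) B(3) span_finite[OF fin] by auto
  obtain j where "g $ j \<noteq> 0" using assms(3) by (auto simp: vec_eq_iff)
  then obtain \<phi> :: "real \<Rightarrow> rat" where
    add: "\<And>x y. \<phi> (x + y) = \<phi> x + \<phi> y" and
    scale: "\<And>q x. \<phi> (of_rat q * x) = q * \<phi> x" and \<phi>1: "\<phi> (g $ j) = 1"
    by (rule rational_linear_functional) blast
  have zero: "\<phi> 0 = 0" using scale[of 0 0] by simp
  have sum: "\<phi> (\<Sum>b\<in>A. f b) = (\<Sum>b\<in>A. \<phi> (f b))" for A and f :: "real ^ 'a \<Rightarrow> real"
    by (induction A rule: infinite_finite_induct) (auto simp: zero add)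
  define h :: "real ^ 'a" where "h = (\<chi> i. of_rat (\<phi> (g $ i)))"
  \<comment> \<open>The basis entries are rational and so pass through \<open>\<phi>\<close>. Hence
    \<open>h\<close> is again a combination of \<open>B\<close>, with coefficients
    \<open>\<phi> (c b)\<close>, and lies in \<open>W\<close>.\<close>
  have "of_rat (\<phi> (c b * b $ i)) = of_rat (\<phi> (c b)) * b $ i" if b: "b \<in> B" for b i
  proof -
    obtain q where q: "b $ i = of_rat q" using B(1)[OF b] by (auto elim: Rats_cases)
    show ?thesis using scale[of q "c b"] by (simp add: q mult.commute of_rat_mult)
  qed
  then have "h = (\<Sum>b\<in>B. of_rat (\<phi> (c b)) *\<^sub>R b)"
    by (simp add: h_def c vec_eq_iff sum of_rat_sum)
  then have "h \<in> W" using B(3) by (auto intro: span_sum span_scale span_base)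
  moreover have "h \<noteq> 0" using \<phi>1 by (auto simp: h_def vec_eq_iff intro!: exI[of _ j])
  moreover have "supp h \<subseteq> supp g" by (auto simp: h_def supp_def zero)
  moreover have "h $ i \<in> \<rat>" for i by (simp add: h_def)
  ultimately show thesis using that by blast
qed

section \<open>Primitive integer vectors of circuits\<close>

lemma rational_vector_multiple_primitive:
  fixes h :: "real ^ 'n"
  assumes "h \<noteq> 0" "\<And>i. h $ i \<in> \<rat>"
  obtains g :: "int ^ 'n" and c where "real_vec g = c *\<^sub>R h" "c \<noteq> 0" "Gcd (range (\<lambda>i. g $ i)) = 1"
proof -
  have "\<exists>D::int. D > 0 \<and> of_int D * h $ i \<in> \<int>" for i
  proof -
    obtain a b :: int where "b > 0" "h $ i = of_int a / of_int b"
      using assms(2)[of i] by (rule Rats_cases')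
    then show ?thesis by (intro exI[of _ b]) auto
  qed
  then obtain D :: "'n \<Rightarrow> int" where D: "\<And>i. D i > 0" "\<And>i. of_int (D i) * h $ i \<in> \<int>"
    by metis
  \<comment> \<open>A common denominator of all entries of \<open>h\<close>; dividing the cleared
    entries by their gcd \<open>G\<close> then makes them coprime.\<close>
  define E where "E = (\<Prod>i\<in>UNIV. D i)"
  have "E > 0" unfolding E_def by (intro prod_pos) (use D in auto)
  have "of_int E * h $ i \<in> \<int>" for i
  proof -
    have "E = (\<Prod>j\<in>UNIV - {i}. D j) * D i"
      unfolding E_def by (subst prod.remove[of UNIV i]) auto
    then have "of_int E * h $ i = of_int (\<Prod>j\<in>UNIV - {i}. D j) * (of_int (D i) * h $ i)"
      by simp
    also have "\<dots> \<in> \<int>" using D(2)[of i] by (rule Ints_mult[OF Ints_of_int])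
    finally show ?thesis .
  qed
  then have "\<forall>i. \<exists>m. of_int E * h $ i = of_int m" by (meson Ints_cases)
  then obtain a :: "'n \<Rightarrow> int" where a: "\<And>i. of_int E * h $ i = of_int (a i)"
    by (auto dest: choice)
  define G where "G = Gcd (range a)"
  obtain j where "h $ j \<noteq> 0" using assms(1) by (auto simp: vec_eq_iff)
  then have "a j \<noteq> 0" using a[of j] \<open>E > 0\<close> by auto
  then have "G \<noteq> 0" unfolding G_def by (auto simp: Gcd_0_iff)
  have "G dvd a i" for i unfolding G_def by (rule Gcd_dvd) simp
  then obtain b where b: "\<And>i. a i = G * b i" unfolding dvd_def by metis
  have "a = (\<lambda>i. G * b i)" using b by (rule ext)
  then have "Gcd (range a) = Gcd ((*) G ` range b)" by (simp only: image_image)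
  then have "G = normalize (G * Gcd (range b))" unfolding Gcd_mult G_def[symmetric] .
  moreover have "G \<ge> 0" unfolding G_def by (rule Gcd_int_greater_eq_0)
  ultimately have "G * Gcd (range b) = G * 1" by (simp add: abs_mult)
  then have Gb: "Gcd (range b) = 1" using \<open>G \<noteq> 0\<close> by simp
  show thesis
  proof (rule that)
    show "real_vec (\<chi> i. b i) = (of_int E / of_int G) *\<^sub>R h"
      using a b \<open>G \<noteq> 0\<close> by (simp add: real_vec_def vec_eq_iff field_simps)
  qed (use \<open>E > 0\<close> \<open>G \<noteq> 0\<close> Gb in auto)
qed

text \<open>The choice in \<open>circuit_vector\<close> succeeds: a rational vector inside the
  support of an elementary vector has a primitive integer multiple, and minimality forces its
  support to be all of \<open>C\<close>.\<close>

lemma circuit_vector_props: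
  assumes W: "rational_subspace W" and "circuit W C"
  shows "elementary_vector W (real_vec (circuit_vector W C))"
    and "supp (real_vec (circuit_vector W C)) = C"
    and "Gcd (range (\<lambda>i. circuit_vector W C $ i)) = 1"
proof -
  have sub: "subspace W" using W by (simp add: rational_subspace_def)
  obtain e where e: "elementary_vector W e" "C = supp e"
    using assms(2) by (auto simp: circuit_def)
  then obtain h where h: "h \<in> W" "h \<noteq> 0" "supp h \<subseteq> supp e" "\<And>i. h $ i \<in> \<rat>"
    using rational_vector_in_supp[OF W, of e] by (auto simp: elementary_vector_def)
  obtain g :: "int ^ 'a" and c
    where g: "real_vec g = c *\<^sub>R h" "c \<noteq> 0" "Gcd (range (\<lambda>i. g $ i)) = 1"
    using rational_vector_multiple_primitive[OF h(2,4)] by blast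
  have "real_vec g \<in> W" "real_vec g \<noteq> 0" "supp (real_vec g) \<subseteq> supp e"
    using g h sub by (auto simp: supp_def intro: subspace_scale)
  from elementary_vector_same_supp[OF e(1) this] g(3) e(2)
  have "\<exists>g. elementary_vector W (real_vec g) \<and> supp (real_vec g) = C \<and>
              Gcd (range (\<lambda>i. g $ i)) = 1" by blast
  from someI_ex[OF this] show
    "elementary_vector W (real_vec (circuit_vector W C))"
    "supp (real_vec (circuit_vector W C)) = C"
    "Gcd (range (\<lambda>i. circuit_vector W C $ i)) = 1"
    unfolding circuit_vector_def by blast+
qed

lemma circuit_vector_nonzero_iff:
  assumes "rational_subspace W" "circuit W C"
  shows "circuit_vector W C $ i \<noteq> 0 \<longleftrightarrow> i \<in> C"
  using circuit_vector_props(2)[OF assms] by (auto simp: supp_def real_vec_def)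

section \<open>The lcm over all circuits\<close>

text \<open>The two trivial subspaces fit the general formula: \<open>{0}\<close> has no circuits,
  and the circuits of the whole space are singletons, with primitive entry 1 or -1. Later arguments
  thus avoid the case distinction.\<close>

lemma lcm_circuit_imbalance_eq_Lcm:
  fixes W :: "(real ^ 'n) set"
  assumes W: "rational_subspace W"
  shows "lcm_circuit_imbalance W =
    Lcm {nat \<bar>circuit_vector W C $ i\<bar> | C i. circuit W C \<and> i \<in> C}"
proof -
  consider "W = {0}" | "W = UNIV" | "W \<noteq> {0}" "W \<noteq> UNIV" by blast
  then show ?thesis
  proof cases
    case 1
    then have "\<not> circuit W C" for C by (auto simp: circuit_def elementary_vector_def)
    then show ?thesis using 1 by (simp add: lcm_circuit_imbalance_def)
  next
    case 2
    have "nat \<bar>circuit_vector W C $ i\<bar> = 1" if C: "circuit W C" "i \<in> C" for C i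
    proof -
      obtain g where g: "elementary_vector W g" "C = supp g"
        using C by (auto simp: circuit_def)
      \<comment> \<open>The unit vector at \<open>i\<close> competes with \<open>g\<close> inside
        \<open>C\<close>, so minimality shrinks \<open>C\<close> to \<open>{i}\<close>.\<close>
      have "supp (axis i 1 :: real ^ 'n) = {i}" by (auto simp: supp_def axis_def)
      moreover have "(axis i 1 :: real ^ 'n) \<noteq> 0" by (simp add: axis_eq_0_iff)
      ultimately have "supp (axis i 1 :: real ^ 'n) = C"
        using elementary_vector_same_supp(2)[OF g(1), of "axis i 1"] C(2) 2 g(2) by auto
      then have "C = {i}" using \<open>supp (axis i 1 :: real ^ 'n) = {i}\<close> by simp
      then have "circuit_vector W C $ i dvd circuit_vector W C $ j" for j
        using circuit_vector_nonzero_iff[OF W C(1), of j] by (cases "j = i") auto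
      then have "circuit_vector W C $ i dvd Gcd (range (\<lambda>j. circuit_vector W C $ j))"
        by (intro Gcd_greatest) auto
      then show ?thesis using circuit_vector_props(3)[OF W C(1)] by simp
    qed
    then have "Lcm {nat \<bar>circuit_vector W C $ i\<bar> | C i. circuit W C \<and> i \<in> C} dvd 1"
      by (intro Lcm_least) auto
    then show ?thesis using 2 by (simp add: lcm_circuit_imbalance_def)
  next
    case 3
    then show ?thesis by (simp add: lcm_circuit_imbalance_def)
  qed
qed

lemma lcm_circuit_imbalance_pos:
  fixes W :: "(real ^ 'n) set"
  assumes W: "rational_subspace W"
  shows "0 < lcm_circuit_imbalance W"
proof -
  let ?S = "{nat \<bar>circuit_vector W C $ i\<bar> | C i. circuit W C \<and> i \<in> C}"
  \<comment> \<open>Finiteness matters because the \<open>Lcm\<close> of an infinite set of naturals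
    is 0.\<close>
  have "?S \<subseteq> (\<lambda>(C, i). nat \<bar>circuit_vector W C $ i\<bar>) ` UNIV" by auto
  then have "finite ?S" by (rule finite_subset) simp
  moreover have "0 \<notin> ?S" using circuit_vector_nonzero_iff[OF W] by auto
  ultimately have "Lcm ?S \<noteq> 0" by (simp add: Lcm_0_iff)
  then show ?thesis using lcm_circuit_imbalance_eq_Lcm[OF W] by simp
qed

lemma circuit_vector_dvd_lcm_circuit_imbalance:
  assumes W: "rational_subspace W" and "circuit W C" "i \<in> C"
  shows "circuit_vector W C $ i dvd int (lcm_circuit_imbalance W)"
proof -
  have "nat \<bar>circuit_vector W C $ i\<bar> dvd lcm_circuit_imbalance W"
    unfolding lcm_circuit_imbalance_eq_Lcm[OF W] using assms by (intro dvd_Lcm) auto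
  then show ?thesis by simp
qed

text \<open>Normalised to 1 at \<open>j\<close>, \<open>g\<close> is the circuit vector divided by
  its entry at \<open>j\<close>, and that entry divides the lcm.\<close>

lemma elementary_vector_ratio_integral:
  assumes W: "rational_subspace W" and g: "elementary_vector W g" "g $ j = 1"
  shows "real (lcm_circuit_imbalance W) * g $ i \<in> \<int>"
proof -
  let ?C = "supp g" let ?v = "circuit_vector W ?C"
  have C: "circuit W ?C" "j \<in> ?C" using g by (auto simp: circuit_def supp_def)
  have j: "?v $ j \<noteq> 0" using circuit_vector_nonzero_iff[OF W C(1)] C(2) by simp
  have "g = (g $ j / real_vec ?v $ j) *\<^sub>R real_vec ?v"
  proof (rule elementary_vector_proportional)
    show "subspace W" using W by (simp add: rational_subspace_def)
    show "g \<in> W" using g(1) by (simp add: elementary_vector_def)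
  qed (use circuit_vector_props[OF W C(1)] j in \<open>auto simp: real_vec_def\<close>)
  then have gi: "g $ i = of_int (?v $ i) / of_int (?v $ j)"
    using g(2) by (metis divide_inverse inverse_eq_divide mult.commute real_scaleR_def
        real_vec_def vec_lambda_beta vector_scaleR_component)
  obtain m where "int (lcm_circuit_imbalance W) = ?v $ j * m"
    using circuit_vector_dvd_lcm_circuit_imbalance[OF W C] by (auto simp: dvd_def)
  then have "real (lcm_circuit_imbalance W) = of_int (?v $ j) * of_int m"
    by (metis of_int_mult of_int_of_nat_eq)
  then have "real (lcm_circuit_imbalance W) * g $ i = of_int (m * ?v $ i)"
    using j by (simp add: gi)
  then show ?thesis by (metis Ints_of_int)
qed

section \<open>Vectors determined by a set of coordinates\<close>

lemma integral_on_determining_set: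
  fixes W :: "(real ^ 'n) set" and N :: "'n set"
  assumes W: "rational_subspace W"
    and N: "\<And>w. w \<in> W \<Longrightarrow> (\<And>i. i \<in> N \<Longrightarrow> w $ i = 0) \<Longrightarrow> w = 0"
    and w: "w \<in> W" "\<And>i. i \<in> N \<Longrightarrow> w $ i \<in> \<int>"
  shows "real (lcm_circuit_imbalance W) * w $ i \<in> \<int>"
proof -
  have sub: "subspace W" using W by (simp add: rational_subspace_def)
  define det where "det M \<longleftrightarrow> (\<forall>w\<in>W. (\<forall>i\<in>M. w $ i = 0) \<longrightarrow> w = 0)" for M :: "'n set"
  obtain M where M: "M \<subseteq> N" "det M" "\<And>M'. M' \<subseteq> M \<Longrightarrow> det M' \<Longrightarrow> M' = M"
  proof -
    have "finite {M. M \<subseteq> N \<and> det M}" "N \<in> {M. M \<subseteq> N \<and> det M}"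
      using N by (auto simp: det_def)
    from finite_has_minimal2[OF this] show thesis
      by (smt (verit) mem_Collect_eq subset_trans that)
  qed
  have "\<exists>g\<in>W. g $ j = 1 \<and> (\<forall>i\<in>M - {j}. g $ i = 0)" if j: "j \<in> M" for j
  proof -
    \<comment> \<open>By minimality of \<open>M\<close>, some nonzero vector of \<open>W\<close>
      vanishes on \<open>M - {j}\<close>. It cannot vanish at \<open>j\<close> as well, so it can be
      scaled to 1 there.\<close>
    have "\<not> det (M - {j})" using M(3)[of "M - {j}"] j by auto
    then obtain h where h: "h \<in> W" "\<forall>i\<in>M - {j}. h $ i = 0" "h \<noteq> 0" by (auto simp: det_def)
    have "h $ j \<noteq> 0" using M(2) h unfolding det_def by (metis Diff_iff singletonD)
    then show ?thesis using h sub
      by (intro bexI[of _ "(1 / h $ j) *\<^sub>R h"]) (auto intro: subspace_scale)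
  qed
  then obtain g where g: "\<And>j. j \<in> M \<Longrightarrow> g j \<in> W" "\<And>j. j \<in> M \<Longrightarrow> g j $ j = 1"
    "\<And>i j. j \<in> M \<Longrightarrow> i \<in> M \<Longrightarrow> i \<noteq> j \<Longrightarrow> g j $ i = 0"
    by (metis Diff_iff singletonD)
  have el: "elementary_vector W (g j)" if j: "j \<in> M" for j
    unfolding elementary_vector_def
  proof (intro conjI ballI impI notI)
    show "g j \<in> W" using g j by simp
    show False if "g j = 0" using g(2)[OF j] that by simp
    fix h assume h: "h \<in> W" "h \<noteq> 0" "supp h \<subset> supp (g j)"
    have z: "h $ i = 0" if "i \<in> M" "i \<noteq> j" for i
      using h(3) g(3)[OF j that] by (auto simp: supp_def)
    \<comment> \<open>This difference vanishes on all of \<open>M\<close>, so \<open>h\<close> is a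
      multiple of \<open>g j\<close> and cannot have smaller support.\<close>
    have "h - h $ j *\<^sub>R g j \<in> W" using h g j sub by (intro subspace_diff subspace_scale) auto
    moreover have "(h - h $ j *\<^sub>R g j) $ i = 0" if "i \<in> M" for i
      using that g(2,3)[OF j] z by (cases "i = j") auto
    ultimately have eq: "h = h $ j *\<^sub>R g j" using M(2) by (auto simp: det_def)
    then have "h $ j \<noteq> 0" using h(2) by auto
    then have "supp h = supp (g j)" by (subst eq) (auto simp: supp_def)
    then show False using h(3) by simp
  qed
  have "w - (\<Sum>j\<in>M. w $ j *\<^sub>R g j) \<in> W"
    using w(1) g(1) sub by (intro subspace_diff subspace_sum subspace_scale) auto
  moreover have "(w - (\<Sum>j\<in>M. w $ j *\<^sub>R g j)) $ i = 0" if "i \<in> M" for i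
  proof -
    have "(\<Sum>j\<in>M. w $ j * g j $ i) = (\<Sum>j\<in>M. if j = i then w $ i else 0)"
      using g(2,3) that by (intro sum.cong) auto
    then show ?thesis using that by simp
  qed
  ultimately have eq: "w = (\<Sum>j\<in>M. w $ j *\<^sub>R g j)" using M(2) by (auto simp: det_def)
  have "real (lcm_circuit_imbalance W) * w $ i
      = (\<Sum>j\<in>M. w $ j * (real (lcm_circuit_imbalance W) * g j $ i))"
    by (subst eq) (simp add: sum_distrib_left mult_ac)
  also have "\<dots> \<in> \<int>"
  proof (rule Ints_sum)
    fix j assume "j \<in> M"
    then show "w $ j * (real (lcm_circuit_imbalance W) * g j $ i) \<in> \<int>"
      using w(2) M(1) el g(2) elementary_vector_ratio_integral[OF W]
      by (meson Ints_mult subsetD)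
  qed
  finally show ?thesis .
qed

section \<open>Vertices\<close>

lemma mem_translate_polyhedron_iff:
  "x \<in> translate_polyhedron W d \<longleftrightarrow> x - real_vec d \<in> W \<and> (\<forall>i. 0 \<le> x $ i)"
proof -
  have "x \<in> (\<lambda>w. w + real_vec d) ` W \<longleftrightarrow> x - real_vec d \<in> W"
    by (auto intro: rev_image_eqI)
  then show ?thesis by (simp add: translate_polyhedron_def)
qed

text \<open>A nonzero \<open>w\<close> vanishing on the zero coordinates of \<open>x\<close> allows
  a small move both ways along \<open>w\<close>. Conversely, the difference of the endpoints of a
  segment through \<open>x\<close> is such a \<open>w\<close>.\<close>

lemma extreme_point_translate_polyhedron_iff:
  fixes W :: "(real ^ 'n) set"
  assumes sub: "subspace W"
  shows "x extreme_point_of translate_polyhedron W d \<longleftrightarrow>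
    x \<in> translate_polyhedron W d \<and> (\<forall>w\<in>W. (\<forall>i. x $ i = 0 \<longrightarrow> w $ i = 0) \<longrightarrow> w = 0)"
    (is "?L \<longleftrightarrow> ?x \<and> ?R")
proof
  assume L: ?L
  then have x: ?x by (simp add: extreme_point_of_def)
  have ?R
  proof (intro ballI impI, rule ccontr)
    fix w assume w: "w \<in> W" "\<forall>i. x $ i = 0 \<longrightarrow> w $ i = 0" "w \<noteq> 0"
    \<comment> \<open>The largest step for which both \<open>x + \<epsilon> *\<^sub>R w\<close> and
      \<open>x - \<epsilon> *\<^sub>R w\<close> stay nonnegative.\<close>
    define \<epsilon> where "\<epsilon> = Min ((\<lambda>i. x $ i / \<bar>w $ i\<bar>) ` supp w)"
    have "supp w \<noteq> {}" using w(3) by (auto simp: supp_def vec_eq_iff)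
    moreover have "0 < x $ i / \<bar>w $ i\<bar>" if "i \<in> supp w" for i
      using that w(2) x by (auto simp: supp_def mem_translate_polyhedron_iff less_le)
    ultimately have pos: "0 < \<epsilon>" by (simp add: \<epsilon>_def)
    have le: "\<epsilon> * \<bar>w $ i\<bar> \<le> x $ i" for i
    proof (cases "i \<in> supp w")
      case True
      then have "\<epsilon> \<le> x $ i / \<bar>w $ i\<bar>" unfolding \<epsilon>_def by (intro Min_le) auto
      then show ?thesis using True by (simp add: field_simps supp_def)
    next
      case False
      then show ?thesis using x by (simp add: supp_def mem_translate_polyhedron_iff)
    qed
    have mem: "x + t *\<^sub>R w \<in> translate_polyhedron W d" if t: "\<bar>t\<bar> = \<epsilon>" for t
      unfolding mem_translate_polyhedron_iff
    proof (intro conjI allI)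
      have "(x - real_vec d) + t *\<^sub>R w \<in> W"
        using x w(1) sub by (intro subspace_add subspace_scale)
          (auto simp: mem_translate_polyhedron_iff)
      then show "x + t *\<^sub>R w - real_vec d \<in> W" by (simp add: algebra_simps)
      show "0 \<le> (x + t *\<^sub>R w) $ i" for i
        using le[of i] abs_mult[of t "w $ i"] t by simp
    qed
    let ?a = "x + (-\<epsilon>) *\<^sub>R w" and ?b = "x + \<epsilon> *\<^sub>R w"
    have "midpoint ?a ?b = x" by (simp add: midpoint_def vec_eq_iff)
    moreover have "?a \<noteq> ?b" using pos w(3) by (auto simp: vec_eq_iff)
    ultimately have "x \<in> open_segment ?a ?b" by (metis midpoint_in_open_segment)
    then show False
      using L mem[of \<epsilon>] mem[of "-\<epsilon>"] pos by (auto simp: extreme_point_of_def)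
  qed
  with x show "?x \<and> ?R" by blast
next
  assume R: "?x \<and> ?R"
  show ?L unfolding extreme_point_of_def
  proof (intro conjI ballI notI)
    show ?x using R by simp
    fix a b assume ab: "a \<in> translate_polyhedron W d" "b \<in> translate_polyhedron W d"
      and "x \<in> open_segment a b"
    then obtain u where u: "a \<noteq> b" "0 < u" "u < 1" "x = (1 - u) *\<^sub>R a + u *\<^sub>R b"
      by (auto simp: in_segment)
    have "(b - real_vec d) - (a - real_vec d) \<in> W"
      using ab by (intro subspace_diff[OF sub, of "b - real_vec d"])
        (simp_all add: mem_translate_polyhedron_iff)
    then have "b - a \<in> W" by simp
    moreover have "(b - a) $ i = 0" if "x $ i = 0" for i
    proof -
      have "0 \<le> a $ i" "0 \<le> b $ i" using ab by (auto simp: mem_translate_polyhedron_iff)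
      moreover have "(1 - u) * a $ i + u * b $ i = 0" using that u(4) by simp
      \<comment> \<open>Two nonnegative terms with sum zero both vanish.\<close>
      ultimately have "(1 - u) * a $ i = 0" "u * b $ i = 0"
        using u(2,3) by (auto simp: add_nonneg_eq_0_iff)
      then show ?thesis using u(2,3) by simp
    qed
    ultimately show False using R u(1) by auto
  qed
qed

section \<open>The two directions of the characterisation\<close>

lemma vertex_inverse_integral:
  assumes W: "rational_subspace W"
  shows "inverse_integral_polyhedron (lcm_circuit_imbalance W) (translate_polyhedron W d)"
  unfolding inverse_integral_polyhedron_def
proof (intro allI impI)
  fix x i assume "x extreme_point_of translate_polyhedron W d"
  then have x: "x - real_vec d \<in> W" and
    det: "\<And>w. w \<in> W \<Longrightarrow> (\<And>i. i \<in> {i. x $ i = 0} \<Longrightarrow> w $ i = 0) \<Longrightarrow> w = 0"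
    using W by (auto simp: extreme_point_translate_polyhedron_iff
        mem_translate_polyhedron_iff rational_subspace_def)
  \<comment> \<open>On the zero coordinates of \<open>x\<close> the vector
    \<open>x - real_vec d\<close> equals \<open>- real_vec d\<close>, which is integral.\<close>
  have "real (lcm_circuit_imbalance W) * (x - real_vec d) $ i \<in> \<int>"
    by (rule integral_on_determining_set[OF W, where N = "{i. x $ i = 0}"])
      (use det x in \<open>auto simp: real_vec_def\<close>)
  then have "real (lcm_circuit_imbalance W) * (x - real_vec d) $ i
      + of_int (int (lcm_circuit_imbalance W) * d $ i) \<in> \<int>"
    by (rule Ints_add) (rule Ints_of_int)
  then have "real (lcm_circuit_imbalance W) * x $ i \<in> \<int>"
    by (simp add: real_vec_def algebra_simps)
  then show "inverse_integral (lcm_circuit_imbalance W) (x $ i)"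
    using inverse_integral_iff lcm_circuit_imbalance_pos[OF W] by blast
qed

lemma circuit_vector_dvd:
  fixes W :: "(real ^ 'n) set"
  assumes W: "rational_subspace W" and "circuit W C" "i \<in> C" and k: "0 < k"
    and int: "\<And>d. inverse_integral_polyhedron k (translate_polyhedron W d)"
  shows "circuit_vector W C $ i dvd int k"
proof -
  define v where "v = circuit_vector W C"
  note v = circuit_vector_props[OF W assms(2), folded v_def]
  have vi: "v $ i \<noteq> 0" using circuit_vector_nonzero_iff[OF W assms(2)] assms(3) by (simp add: v_def)
  have sub: "subspace W" using W by (simp add: rational_subspace_def)
  \<comment> \<open>Rounding up makes \<open>x\<close> nonnegative. Outside \<open>C\<close> the
    ratio is 0, so \<open>d\<close> and \<open>x\<close> vanish there; at \<open>i\<close> the ratio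
    is 1, so \<open>x\<close> vanishes there too.\<close>
  define d :: "int ^ 'n"
    where "d = (\<chi> j. if j = i then 1 else \<lceil>of_int (v $ j) / of_int (v $ i) :: real\<rceil>)"
  define x where "x = real_vec d - (1 / of_int (v $ i)) *\<^sub>R real_vec v"
  have x_nth: "x $ j = of_int (d $ j) - of_int (v $ j) / of_int (v $ i)" for j
    by (simp add: x_def real_vec_def)
  have xi: "x $ i = 0" using vi by (simp add: x_nth d_def)
  have "x extreme_point_of translate_polyhedron W d"
    unfolding extreme_point_translate_polyhedron_iff[OF sub] mem_translate_polyhedron_iff
  proof (intro conjI ballI impI allI)
    have "(- 1 / of_int (v $ i)) *\<^sub>R real_vec v \<in> W"
      using v(1) sub by (intro subspace_scale) (auto simp: elementary_vector_def)
    then show "x - real_vec d \<in> W" by (simp add: x_def)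
    show "0 \<le> x $ j" for j using xi by (cases "j = i") (auto simp: x_nth d_def)
    fix w assume w: "w \<in> W" "\<forall>j. x $ j = 0 \<longrightarrow> w $ j = 0"
    have "x $ j = 0" if "j \<notin> C" for j
      using that xi circuit_vector_nonzero_iff[OF W assms(2), of j]
      by (cases "j = i") (auto simp: x_nth d_def v_def)
    \<comment> \<open>A vector supported in \<open>C\<close> is a multiple of \<open>v\<close>, and
      its zero at \<open>i\<close> makes the factor zero.\<close>
    then have "supp w \<subseteq> supp (real_vec v)" using w(2) v(2) by (auto simp: supp_def)
    then have "w = (w $ i / real_vec v $ i) *\<^sub>R real_vec v"
      using vi by (intro elementary_vector_proportional[OF sub v(1) w(1)]) (auto simp: real_vec_def)
    moreover have "w $ i = 0" using w(2) xi by simp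
    ultimately show "w = 0" by simp
  qed
  then have ints: "real k * x $ j \<in> \<int>" for j
    using int[of d] inverse_integral_iff[OF k] by (auto simp: inverse_integral_polyhedron_def)
  have "v $ i dvd int k * v $ j" for j
  proof -
    \<comment> \<open>This difference is \<open>k\<close> times the ratio of \<open>v $ j\<close> to
      \<open>v $ i\<close>.\<close>
    have "of_int (int k * d $ j) - real k * x $ j \<in> \<int>"
      using ints[of j] by (intro Ints_diff Ints_of_int)
    then have "real k * (of_int (v $ j) / of_int (v $ i)) \<in> \<int>"
      by (simp add: x_nth algebra_simps)
    then obtain m where "real k * (of_int (v $ j) / of_int (v $ i)) = of_int m"
      by (rule Ints_cases)
    then have "real_of_int (int k * v $ j) = of_int (v $ i * m)"
      using vi by (simp add: field_simps)
    then show ?thesis by (metis of_int_eq_iff dvd_triv_left)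
  qed
  \<comment> \<open>The entries of \<open>v\<close> are coprime, so the gcd of their multiples by
    \<open>k\<close> is \<open>k\<close> itself.\<close>
  then have "v $ i dvd Gcd ((*) (int k) ` range (\<lambda>j. v $ j))" by (intro Gcd_greatest) auto
  then show ?thesis using v(3) by (simp add: Gcd_mult v_def)
qed

theorem theorem3p8:
  fixes W :: "(real ^ 'n) set"
  assumes "rational_subspace W"
  shows "0 < lcm_circuit_imbalance W \<and>
    (\<forall>d. inverse_integral_polyhedron (lcm_circuit_imbalance W) (translate_polyhedron W d)) \<and>
    (\<forall>k>0. (\<forall>d. inverse_integral_polyhedron k (translate_polyhedron W d)) \<longrightarrow>
      lcm_circuit_imbalance W \<le> k)"
proof (intro conjI allI impI)
  fix k :: nat
  assume k: "0 < k" "\<forall>d. inverse_integral_polyhedron k (translate_polyhedron W d)"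
  \<comment> \<open>More than minimality holds: every admissible \<open>k\<close> is a multiple of
    the lcm.\<close>
  have "lcm_circuit_imbalance W dvd k"
    unfolding lcm_circuit_imbalance_eq_Lcm[OF assms]
    using circuit_vector_dvd[OF assms] k by (intro Lcm_least) auto
  then show "lcm_circuit_imbalance W \<le> k" using k(1) by (rule dvd_imp_le)
qed (use assms lcm_circuit_imbalance_pos vertex_inverse_integral in auto)

end
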